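(* Let $1\le p<\infty$. Assume that the $A_p$ condition holds for the weights $w_1$ and $w_2$ with a constant $C$ in some ball $B\subset\mathbf{R}^n$. Then it holds in $B$ also for $w_1+w_2$, $\max\{w_1,w_2\}$ and $\min\{w_1,w_2\}$ with constants $2C$, $2C$ and $2^{p-1}C$, respectively.
   Context: A weight is a nonnegative measurable function. The $A_p$ condition holds for $w$ with constant $C$ in the (single) ball $B$ if $$\frac{1}{|B|}\int_B w\,dx< C\Bigl(\frac{1}{|B|}\int_B w^{1/(1-p)}\,dx\Bigr)^{1-p}\quad\text{when }1<p<\infty,\qquad \frac{1}{|B|}\int_B w\,dx< C\operatorname*{ess\,inf}_B w\quad\text{when }p=1.$$ *)

theory Defs
  imports "HOL-Analysis.Analysis"
begin

(* Weights take values in [0,\<infinity>], so nonnegativity is part of the type; a finite-valued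
   weight is the special case \<open>\<lambda>x. ennreal (v x)\<close> with v nonnegative. *)
definition weight :: "('a::euclidean_space \<Rightarrow> ennreal) \<Rightarrow> bool" where
  "weight w \<longleftrightarrow> w \<in> borel_measurable lebesgue"

(* Real powers on [0,\<infinity>], with 0^a = \<infinity> and \<infinity>^a = 0 for a < 0.
   The library's powr on the reals has 0 powr a = 0 for every a, which would make a
   weight that vanishes on a set of positive measure look admissible. *)
definition ennreal_powr :: "ennreal \<Rightarrow> real \<Rightarrow> ennreal" where
  "ennreal_powr x a =
     (if a = 0 then 1
      else if x = 0 then (if a < 0 then \<infinity> else 0)
      else if x = \<infinity> then (if a < 0 then 0 else \<infinity>)
      else ennreal (enn2real x powr a))"

definition average :: "'a::euclidean_space set \<Rightarrow> ('a \<Rightarrow> ennreal) \<Rightarrow> ennreal" where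
  "average B f = (\<integral>\<^sup>+x\<in>B. f x \<partial>lebesgue) / emeasure lebesgue B"

definition essinf :: "'a::euclidean_space set \<Rightarrow> ('a \<Rightarrow> ennreal) \<Rightarrow> ennreal" where
  "essinf B f = Sup {c. AE x\<in>B in lebesgue. c \<le> f x}"

(* Only meant for 1 \<le> p. For C \<le> 0 the condition is never satisfied, so that the
   truncation of negative numbers by ennreal is harmless. *)
definition Ap_condition ::
    "real \<Rightarrow> real \<Rightarrow> 'a::euclidean_space set \<Rightarrow> ('a \<Rightarrow> ennreal) \<Rightarrow> bool" where
  "Ap_condition p C B w \<longleftrightarrow>
     (if p = 1
      then average B w < ennreal C * essinf B w
      else average B w
           < ennreal C * ennreal_powr (average B (\<lambda>x. ennreal_powr (w x) (1 / (1 - p)))) (1 - p))"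

end

theory Submission
  imports Defs
begin

text \<open>The right-hand side of the condition is \<open>C \<cdot> \<Phi>(w)\<close> with \<open>\<Phi>\<close> monotone in \<open>w\<close>. For the sum and the
  maximum one adds the two conditions and bounds \<open>\<Phi>(w1) + \<Phi>(w2)\<close> by \<open>2 \<Phi>\<close> of the larger weight.
  For the minimum, \<open>min(w1,w2)\<^sup>s \<le> w1\<^sup>s + w2\<^sup>s\<close> with \<open>s = 1/(1-p) < 0\<close>, so its average is at most twice
  the larger of the two averages; taking the power \<open>1 - p\<close> costs the factor \<open>2\<^bsup>p-1\<^esup>\<close>.\<close>

text \<open>The values \<infinity> at 0 and 0 at \<infinity> settle the extreme cases; otherwise
  both arguments are positive reals.\<close>

lemma ennreal_powr_antimono:
  assumes "a < 0" "x \<le> y"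
  shows "ennreal_powr y a \<le> ennreal_powr x a"
proof (cases "x = 0 \<or> y = \<infinity>")
  case True
  then show ?thesis using assms by (auto simp: ennreal_powr_def)
next
  case False
  then have "x \<noteq> 0" "y \<noteq> 0" "x < \<infinity>" "y < \<infinity>"
    using assms(2) by (auto simp: less_top top_unique)
  moreover from this have "0 < enn2real x" "enn2real x \<le> enn2real y"
    using assms(2) by (auto simp: enn2real_positive_iff enn2real_mono zero_less_iff_neq_zero)
  ultimately show ?thesis
    using assms(1) by (auto simp: ennreal_powr_def powr_mono2' intro!: ennreal_leI)
qed

text \<open>The minimum is one of the two arguments, so its power is one of the two summands,
  whatever the sign of \<open>a\<close>.\<close>

lemma ennreal_powr_min_le_add: "ennreal_powr (min x y) a \<le> ennreal_powr x a + ennreal_powr y a"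
  by (simp add: min_def add_increasing add_increasing2)

text \<open>Scaling by a positive finite \<open>c\<close> fixes 0 and \<infinity>, so the
  conventions there are respected.\<close>

lemma ennreal_powr_mult_left:
  assumes "a < 0" "0 < c"
  shows "ennreal_powr (ennreal c * x) a = ennreal (c powr a) * ennreal_powr x a"
proof (cases x)
  case (real t)
  then show ?thesis using assms
    by (auto simp: ennreal_powr_def powr_mult ennreal_mult_top simp flip: ennreal_mult)
next
  case top
  then show ?thesis using assms by (auto simp: ennreal_powr_def ennreal_mult_top)
qed

lemma borel_measurable_ennreal_powr [measurable]:
  assumes [measurable]: "f \<in> borel_measurable M"
  shows "(\<lambda>x. ennreal_powr (f x) a) \<in> borel_measurable M"
  unfolding ennreal_powr_def by measurable

lemma average_mono:
  assumes "\<And>x. f x \<le> g x"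
  shows "average B f \<le> average B g"
  unfolding average_def
  by (intro divide_right_mono_ennreal nn_integral_mono mult_right_mono assms) simp

lemma average_add:
  assumes [measurable]: "f \<in> borel_measurable lebesgue" "g \<in> borel_measurable lebesgue"
    and [measurable]: "B \<in> sets lebesgue"
  shows "average B (\<lambda>x. f x + g x) = average B f + average B g"
  unfolding average_def
  by (simp add: distrib_right nn_integral_add add_divide_distrib_ennreal)

lemma essinf_mono:
  assumes "\<And>x. f x \<le> g x"
  shows "essinf B f \<le> essinf B g"
  unfolding essinf_def
  by (rule Sup_subset_mono) (auto elim!: eventually_mono intro: order_trans[OF _ assms])

lemma min_essinf_le: "min (essinf B f) (essinf B g) \<le> essinf B (\<lambda>x. min (f x) (g x))"
\<comment> \<open>Testing only \<open>c\<close> strictly below both suprema yields essential lower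
  bounds \<open>d\<close> and \<open>e\<close> above \<open>c\<close>; the two exceptional null sets
  are then united.\<close>
proof (rule dense_le)
  fix c assume "c < min (essinf B f) (essinf B g)"
  then obtain d e where "c < d" "AE x\<in>B in lebesgue. d \<le> f x"
    and "c < e" "AE x\<in>B in lebesgue. e \<le> g x"
    by (auto simp: essinf_def less_Sup_iff)
  then have "AE x\<in>B in lebesgue. c \<le> min (f x) (g x)"
    by (auto elim!: eventually_elim2)
  then show "c \<le> essinf B (\<lambda>x. min (f x) (g x))"
    unfolding essinf_def by (auto intro: Sup_upper)
qed

text \<open>This is \<Phi>; it lets the arguments for \<open>p = 1\<close> and \<open>p > 1\<close>
  share one form.\<close>

definition Ap_factor :: "real \<Rightarrow> 'a::euclidean_space set \<Rightarrow> ('a \<Rightarrow> ennreal) \<Rightarrow> ennreal" where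
  "Ap_factor p B w =
     (if p = 1 then essinf B w
      else ennreal_powr (average B (\<lambda>x. ennreal_powr (w x) (1 / (1 - p)))) (1 - p))"

lemma Ap_condition_iff: "Ap_condition p C B w \<longleftrightarrow> average B w < ennreal C * Ap_factor p B w"
  by (simp add: Ap_condition_def Ap_factor_def)

text \<open>For \<open>C \<le> 0\<close> the right-hand side is 0, and nothing in [0,\<infinity>] is
  strictly below 0.\<close>

lemma Ap_condition_pos: "Ap_condition p C B w \<Longrightarrow> 0 < C"
  by (rule ccontr) (simp add: Ap_condition_iff ennreal_neg)

text \<open>For \<open>p > 1\<close> both exponents are negative, so two order reversals
  cancel.\<close>

lemma Ap_factor_mono:
  assumes "1 \<le> p" "\<And>x. v x \<le> w x"
  shows "Ap_factor p B v \<le> Ap_factor p B w"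
  using assms
  by (auto simp: Ap_factor_def intro!: essinf_mono ennreal_powr_antimono average_mono)

text \<open>This is the source of the constant \<open>2 powr (p - 1)\<close>, which equals 1 when
  \<open>p = 1\<close>.\<close>

lemma min_Ap_factor_le:
  assumes "1 \<le> p" "weight v" "weight w" "B \<in> sets lebesgue"
  shows "min (Ap_factor p B v) (Ap_factor p B w)
    \<le> ennreal (2 powr (p - 1)) * Ap_factor p B (\<lambda>x. min (v x) (w x))"
proof (cases "p = 1")
  case True
  then show ?thesis by (simp add: Ap_factor_def min_essinf_le)
next
  case False
  then have p: "1 - p < 0" "1 / (1 - p) < 0" using assms(1) by auto
  define A where "A u = average B (\<lambda>x. ennreal_powr (u x) (1 / (1 - p)))" for u
  have factor: "Ap_factor p B u = ennreal_powr (A u) (1 - p)" for u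
    using False by (simp add: Ap_factor_def A_def)
  have [measurable]: "v \<in> borel_measurable lebesgue" "w \<in> borel_measurable lebesgue"
    using assms by (auto simp: weight_def)
  have "A (\<lambda>x. min (v x) (w x))
      \<le> average B (\<lambda>x. ennreal_powr (v x) (1 / (1 - p)) + ennreal_powr (w x) (1 / (1 - p)))"
    unfolding A_def by (intro average_mono ennreal_powr_min_le_add)
  also have "\<dots> = A v + A w"
    unfolding A_def using assms(4) by (intro average_add) measurable
  \<comment> \<open>The maximum is the right bound because the power \<open>1 - p < 0\<close> turns
    it into the minimum of the two factors.\<close>
  also have "\<dots> \<le> max (A v) (A w) + max (A v) (A w)"
    by (intro add_mono) auto
  also have "\<dots> = ennreal 2 * max (A v) (A w)"
    by (simp add: mult_2)
  finally have "ennreal_powr (ennreal 2 * max (A v) (A w)) (1 - p)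
      \<le> Ap_factor p B (\<lambda>x. min (v x) (w x))"
    unfolding factor by (intro ennreal_powr_antimono p)
  then have "ennreal (2 powr (p - 1)) * (ennreal (2 powr (1 - p)) * ennreal_powr (max (A v) (A w)) (1 - p))
      \<le> ennreal (2 powr (p - 1)) * Ap_factor p B (\<lambda>x. min (v x) (w x))"
    unfolding ennreal_powr_mult_left[OF p(1) zero_less_numeral] by (rule mult_left_mono) simp
  moreover have "ennreal (2 powr (p - 1)) * ennreal (2 powr (1 - p)) = 1"
    by (simp flip: ennreal_mult powr_add)
  moreover have "min (Ap_factor p B v) (Ap_factor p B w) \<le> ennreal_powr (max (A v) (A w)) (1 - p)"
    unfolding factor by (auto simp: max_def)
  ultimately show ?thesis
    by (simp flip: mult.assoc)
qed

text \<open>The sum and the maximum are treated together: each dominates both weights and is at most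
  their sum.\<close>

lemma Ap_condition_of_le_add:
  assumes "1 \<le> p" "weight v" "weight w" "B \<in> sets lebesgue"
    and v: "Ap_condition p C B v" and w: "Ap_condition p C B w"
    and "\<And>x. u x \<le> v x + w x" "\<And>x. v x \<le> u x" "\<And>x. w x \<le> u x"
  shows "Ap_condition p (2 * C) B u"
proof -
  have "average B u \<le> average B (\<lambda>x. v x + w x)"
    by (intro average_mono assms)
  also have "\<dots> = average B v + average B w"
    using assms by (intro average_add) (auto simp: weight_def)
  also have "\<dots> < ennreal C * Ap_factor p B v + ennreal C * Ap_factor p B w"
    using v w unfolding Ap_condition_iff by (rule add_strict_mono)
  also have "\<dots> \<le> ennreal C * Ap_factor p B u + ennreal C * Ap_factor p B u"
    by (intro add_mono mult_left_mono Ap_factor_mono assms) simp_all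
  also have "\<dots> = ennreal (2 * C) * Ap_factor p B u"
    using Ap_condition_pos[OF v] by (simp only: mult_2 ennreal_plus less_imp_le distrib_right)
  finally show ?thesis unfolding Ap_condition_iff .
qed

lemma Ap_condition_min:
  assumes "1 \<le> p" "weight v" "weight w" "B \<in> sets lebesgue"
    and v: "Ap_condition p C B v" and w: "Ap_condition p C B w"
  shows "Ap_condition p (2 powr (p - 1) * C) B (\<lambda>x. min (v x) (w x))" (is "Ap_condition _ _ _ ?m")
proof -
  have "average B ?m \<le> average B v" "average B ?m \<le> average B w"
    by (auto intro: average_mono)
  \<comment> \<open>The average of the minimum lies below both right-hand sides, hence below the
    smaller one; nothing is added, so no factor 2 arises here.\<close>
  then have "average B ?m < ennreal C * min (Ap_factor p B v) (Ap_factor p B w)"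
    using v w unfolding Ap_condition_iff by (auto simp: min_def)
  also have "\<dots> \<le> ennreal C * (ennreal (2 powr (p - 1)) * Ap_factor p B ?m)"
    by (intro mult_left_mono min_Ap_factor_le assms) simp
  also have "\<dots> = ennreal (2 powr (p - 1) * C) * Ap_factor p B ?m"
    using Ap_condition_pos[OF v] by (simp only: ennreal_mult powr_ge_zero less_imp_le ac_simps)
  finally show ?thesis unfolding Ap_condition_iff .
qed

theorem lemma5p3:
  fixes p C r :: real
    and z :: "real ^ 'n"
    and w1 w2 :: "real ^ 'n \<Rightarrow> ennreal"
  assumes "1 \<le> p"
    and "r > 0"
    and "weight w1" and "weight w2"
    and "Ap_condition p C (ball z r) w1"
    and "Ap_condition p C (ball z r) w2"
  shows "Ap_condition p (2 * C) (ball z r) (\<lambda>x. w1 x + w2 x)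
    \<and> Ap_condition p (2 * C) (ball z r) (\<lambda>x. max (w1 x) (w2 x))
    \<and> Ap_condition p (2 powr (p - 1) * C) (ball z r) (\<lambda>x. min (w1 x) (w2 x))"
proof -
  have B: "ball z r \<in> sets lebesgue" by simp
  note hyps = assms(1,3,4) B assms(5,6)
  show ?thesis
    by (intro conjI Ap_condition_min[OF hyps] Ap_condition_of_le_add[OF hyps])
      (auto simp: max_def add_increasing add_increasing2)
qed

end
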